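(* (Block composition of polynomials.) Let $n\ge l$, let $F_b(z)=z^{-1}B_1+\cdots+z^{-n}B_n$ be $p_b\times m_b$-valued and $F_c(z)=z^{-1}C_1+\cdots+z^{-l}C_l$ be $p_c\times m_c$-valued. Put $C_j=0_{p_c\times m_c}$ for $l<j\le n$, and let $F_d(z)=z^{-1}D_1+\cdots+z^{-n}D_n$ be the $(p_b+p_c)\times(m_b+m_c)$-valued polynomial with coefficients either $$D_j=\begin{pmatrix}B_j&0\\0&C_j\end{pmatrix},\quad j=1,\dots,n,\qquad\text{or}\qquad D_j=\begin{pmatrix}0&B_j\\C_j&0\end{pmatrix},\quad j=1,\dots,n.$$ If both $F_b(z)$ and $F_c(z)$ are isometries on $\mathbb{T}$, then so is $F_d(z)$. If both $F_b(z)$ and $F_c(z)$ are co-isometries on $\mathbb{T}$, then so is $F_d(z)$.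
   Context: $\mathbb{T}=\{z\in\mathbb{C}:|z|=1\}$. A $p\times m$-valued function $F$ is an isometry on $\mathbb{T}$ if $p\ge m$ and $F(z)^*F(z)=I_m$ for all $z\in\mathbb{T}$; it is a co-isometry on $\mathbb{T}$ if $m\ge p$ and $F(z)F(z)^*=I_p$ for all $z\in\mathbb{T}$. All coefficients are complex matrices. *)

theory Defs
  imports Complex_Main "Jordan_Normal_Form.Schur_Decomposition"
begin

text \<open>
  The map \<open>z \<mapsto> z\<^sup>-\<^sup>1 A\<^sub>1 + \<dots> + z\<^sup>-\<^sup>n A\<^sub>n\<close>, for \<open>p \<times> m\<close> coefficients \<open>A j\<close>.
  The type of matrices has no zero, so the sum is taken in the module of \<open>p \<times> m\<close> matrices;
  the value \<open>A 0\<close> is not used.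
\<close>

definition inv_poly :: "nat \<Rightarrow> nat \<Rightarrow> nat \<Rightarrow> (nat \<Rightarrow> complex mat) \<Rightarrow> complex \<Rightarrow> complex mat" where
  "inv_poly p m n A z =
    finsum (module_mat TYPE(complex) p m) (\<lambda>j. (z powi (- int j)) \<cdot>\<^sub>m A j) {1..n}"

definition isometry_on_circle :: "nat \<Rightarrow> nat \<Rightarrow> (complex \<Rightarrow> complex mat) \<Rightarrow> bool" where
  "isometry_on_circle p m F \<longleftrightarrow> m \<le> p \<and>
    (\<forall>z. cmod z = 1 \<longrightarrow> F z \<in> carrier_mat p m \<and> mat_adjoint (F z) * F z = 1\<^sub>m m)"

definition coisometry_on_circle :: "nat \<Rightarrow> nat \<Rightarrow> (complex \<Rightarrow> complex mat) \<Rightarrow> bool" where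
  "coisometry_on_circle p m F \<longleftrightarrow> p \<le> m \<and>
    (\<forall>z. cmod z = 1 \<longrightarrow> F z \<in> carrier_mat p m \<and> F z * mat_adjoint (F z) = 1\<^sub>m p)"

end

theory Submission
  imports Defs
begin

text \<open>
  Forming a block matrix is linear in the blocks, so \<open>F\<^sub>d(z)\<close> is, for every \<open>z\<close>, the block diagonal
  or block antidiagonal matrix with blocks \<open>F\<^sub>b(z)\<close> and \<open>F\<^sub>c(z)\<close> (lemmas \<open>inv_poly_block_diag\<close> and
  \<open>inv_poly_block_antidiag\<close>); the zero coefficients appended to \<open>C\<close> do not change \<open>F\<^sub>c\<close>.
  For such a matrix \<open>M\<close> with blocks \<open>X\<close> and \<open>Y\<close>, the products \<open>M\<^sup>*M\<close> and \<open>MM\<^sup>*\<close> are both block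
  diagonal, with blocks \<open>X\<^sup>*X\<close>, \<open>Y\<^sup>*Y\<close> and \<open>XX\<^sup>*\<close>, \<open>YY\<^sup>*\<close> respectively, up to the order of the
  blocks. Identity blocks therefore give an identity matrix.
\<close>

section \<open>Adjoints and products of block matrices\<close>

lemma mat_adjoint_index [simp]:
  "dim_row (mat_adjoint A) = dim_col A"
  "dim_col (mat_adjoint A) = dim_row A"
  "i < dim_col A \<Longrightarrow> j < dim_row A \<Longrightarrow> mat_adjoint A $$ (i, j) = conjugate (A $$ (j, i))"
  by (simp_all add: mat_adjoint_def mat_of_rows_def)

lemma mat_adjoint_carrier [simp]:
  "A \<in> carrier_mat p m \<Longrightarrow> mat_adjoint A \<in> carrier_mat m p"
  by (rule carrier_matI) simp_all

lemma mat_adjoint_four_block_mat: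
  assumes "A \<in> carrier_mat p1 m1" "B \<in> carrier_mat p1 m2"
    "C \<in> carrier_mat p2 m1" "D \<in> carrier_mat p2 m2"
  shows "mat_adjoint (four_block_mat A B C D) =
    four_block_mat (mat_adjoint A) (mat_adjoint C) (mat_adjoint B) (mat_adjoint D)"
  by (rule eq_matI) (use assms in auto)

lemma mat_adjoint_zero [simp]:
  "mat_adjoint (0\<^sub>m p m :: 'a :: conjugatable_field mat) = 0\<^sub>m m p"
  by (rule eq_matI) auto

lemma mult_block_diag:
  fixes X :: "'a :: semiring_1 mat"
  assumes "X \<in> carrier_mat p1 k1" "Y \<in> carrier_mat p2 k2"
    "X' \<in> carrier_mat k1 m1" "Y' \<in> carrier_mat k2 m2"
  shows "four_block_mat X (0\<^sub>m p1 k2) (0\<^sub>m p2 k1) Y *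
      four_block_mat X' (0\<^sub>m k1 m2) (0\<^sub>m k2 m1) Y' =
    four_block_mat (X * X') (0\<^sub>m p1 m2) (0\<^sub>m p2 m1) (Y * Y')"
  by (subst mult_four_block_mat[OF assms(1) zero_carrier_mat zero_carrier_mat assms(2)
        assms(3) zero_carrier_mat zero_carrier_mat assms(4)])
    (use assms in simp)

lemma mult_block_antidiag:
  fixes X :: "'a :: semiring_1 mat"
  assumes "X \<in> carrier_mat p1 k2" "Y \<in> carrier_mat p2 k1"
    "X' \<in> carrier_mat k2 m1" "Y' \<in> carrier_mat k1 m2"
  shows "four_block_mat (0\<^sub>m p1 k1) X Y (0\<^sub>m p2 k2) *
      four_block_mat (0\<^sub>m k1 m1) Y' X' (0\<^sub>m k2 m2) =
    four_block_mat (X * X') (0\<^sub>m p1 m2) (0\<^sub>m p2 m1) (Y * Y')"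
  by (subst mult_four_block_mat[OF zero_carrier_mat assms(1,2) zero_carrier_mat
        zero_carrier_mat assms(4,3) zero_carrier_mat])
    (use assms in simp)

section \<open>Polynomials in the inverse variable with block coefficients\<close>

lemma finsum_mat:
  fixes f :: "'b \<Rightarrow> 'a :: comm_ring_1 mat"
  assumes "finite S" "\<And>j. j \<in> S \<Longrightarrow> f j \<in> carrier_mat p m"
  shows "finsum (module_mat TYPE('a) p m) f S = mat p m (\<lambda>ik. \<Sum>j\<in>S. f j $$ ik)"
  using assms
proof (induction S rule: finite_induct)
  case empty
  interpret abelian_group "module_mat TYPE('a) p m" by (rule abelian_group_mat)
  show ?case by (auto simp: module_mat_simps)
next
  case (insert x S)
  interpret abelian_group "module_mat TYPE('a) p m" by (rule abelian_group_mat)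
  have "finsum (module_mat TYPE('a) p m) f (insert x S) =
      f x + finsum (module_mat TYPE('a) p m) f S"
    using finsum_insert[of S x f] insert.hyps insert.prems
    by (auto simp: module_mat_simps)
  also have "\<dots> = f x + mat p m (\<lambda>ik. \<Sum>j\<in>S. f j $$ ik)"
    using insert by simp
  also have "\<dots> = mat p m (\<lambda>ik. \<Sum>j\<in>insert x S. f j $$ ik)"
    by (rule eq_matI) (use insert.hyps insert.prems in auto)
  finally show ?case .
qed

lemma inv_poly_eq_mat:
  assumes "\<And>j. j \<in> {1..n} \<Longrightarrow> A j \<in> carrier_mat p m"
  shows "inv_poly p m n A z = mat p m (\<lambda>ik. \<Sum>j\<in>{1..n}. z powi (- int j) * A j $$ ik)"
proof -
  have "inv_poly p m n A z =
      mat p m (\<lambda>ik. \<Sum>j\<in>{1..n}. (z powi (- int j) \<cdot>\<^sub>m A j) $$ ik)"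
    unfolding inv_poly_def by (rule finsum_mat) (use assms in auto)
  also have "\<dots> = mat p m (\<lambda>ik. \<Sum>j\<in>{1..n}. z powi (- int j) * A j $$ ik)"
  proof (rule eq_matI; simp)
    fix i k assume "i < p" "k < m"
    show "(\<Sum>j = Suc 0..n. (z powi (- int j) \<cdot>\<^sub>m A j) $$ (i, k)) =
        (\<Sum>j = Suc 0..n. z powi (- int j) * A j $$ (i, k))"
    proof (rule sum.cong[OF refl])
      fix j assume "j \<in> {Suc 0..n}"
      hence "A j \<in> carrier_mat p m" using assms[of j] by simp
      thus "(z powi (- int j) \<cdot>\<^sub>m A j) $$ (i, k) = z powi (- int j) * A j $$ (i, k)"
        using \<open>i < p\<close> \<open>k < m\<close> by (subst index_smult_mat) auto
    qed
  qed
  finally show ?thesis .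
qed

lemma inv_poly_extend_zero:
  assumes "l \<le> n" and A: "\<And>j. j \<in> {1..l} \<Longrightarrow> A j \<in> carrier_mat p m"
    and A0: "\<And>j. j \<in> {l<..n} \<Longrightarrow> A j = 0\<^sub>m p m"
  shows "inv_poly p m n A z = inv_poly p m l A z"
proof -
  have An: "A j \<in> carrier_mat p m" if "j \<in> {1..n}" for j
    using that A[of j] A0[of j] by (cases "j \<le> l") auto
  have eqs:
    "inv_poly p m n A z = mat p m (\<lambda>ik. \<Sum>j\<in>{1..n}. z powi (- int j) * A j $$ ik)"
    "inv_poly p m l A z = mat p m (\<lambda>ik. \<Sum>j\<in>{1..l}. z powi (- int j) * A j $$ ik)"
    using A An by (blast intro: inv_poly_eq_mat)+
  show ?thesis
    unfolding eqs
    by (rule eq_matI) (use \<open>l \<le> n\<close> in \<open>auto simp: A0 intro!: sum.mono_neutral_right\<close>)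
qed

lemma inv_poly_block_diag:
  assumes B: "\<And>j. j \<in> {1..n} \<Longrightarrow> B j \<in> carrier_mat pb mb"
    and C: "\<And>j. j \<in> {1..n} \<Longrightarrow> C j \<in> carrier_mat pc mc"
    and D: "\<And>j. j \<in> {1..n} \<Longrightarrow>
      D j = four_block_mat (B j) (0\<^sub>m pb mc) (0\<^sub>m pc mb) (C j)"
  shows "inv_poly (pb + pc) (mb + mc) n D z =
    four_block_mat (inv_poly pb mb n B z) (0\<^sub>m pb mc) (0\<^sub>m pc mb) (inv_poly pc mc n C z)"
proof -
  have "D j \<in> carrier_mat (pb + pc) (mb + mc)" if "j \<in> {1..n}" for j
    using B[OF that] C[OF that] D[OF that] by simp
  hence eqs:
    "inv_poly (pb + pc) (mb + mc) n D z =
      mat (pb + pc) (mb + mc) (\<lambda>ik. \<Sum>j\<in>{1..n}. z powi (- int j) * D j $$ ik)"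
    "inv_poly pb mb n B z = mat pb mb (\<lambda>ik. \<Sum>j\<in>{1..n}. z powi (- int j) * B j $$ ik)"
    "inv_poly pc mc n C z = mat pc mc (\<lambda>ik. \<Sum>j\<in>{1..n}. z powi (- int j) * C j $$ ik)"
    using B C by (blast intro: inv_poly_eq_mat)+
  have ent: "D j $$ (i, k) =
      (if i < pb then if k < mb then B j $$ (i, k) else 0
       else if k < mb then 0 else C j $$ (i - pb, k - mb))"
    if "j \<in> {1..n}" "i < pb + pc" "k < mb + mc" for j i k
    using that B[OF that(1)] C[OF that(1)] D[OF that(1)] by auto
  show ?thesis
    unfolding eqs by (rule eq_matI) (auto simp: ent)
qed

lemma inv_poly_block_antidiag:
  assumes B: "\<And>j. j \<in> {1..n} \<Longrightarrow> B j \<in> carrier_mat pb mb"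
    and C: "\<And>j. j \<in> {1..n} \<Longrightarrow> C j \<in> carrier_mat pc mc"
    and D: "\<And>j. j \<in> {1..n} \<Longrightarrow>
      D j = four_block_mat (0\<^sub>m pb mc) (B j) (C j) (0\<^sub>m pc mb)"
  shows "inv_poly (pb + pc) (mb + mc) n D z =
    four_block_mat (0\<^sub>m pb mc) (inv_poly pb mb n B z) (inv_poly pc mc n C z) (0\<^sub>m pc mb)"
proof -
  have "D j \<in> carrier_mat (pb + pc) (mb + mc)" if "j \<in> {1..n}" for j
    unfolding D[OF that] by (rule carrier_matI) simp_all
  hence eqs:
    "inv_poly (pb + pc) (mb + mc) n D z =
      mat (pb + pc) (mb + mc) (\<lambda>ik. \<Sum>j\<in>{1..n}. z powi (- int j) * D j $$ ik)"
    "inv_poly pb mb n B z = mat pb mb (\<lambda>ik. \<Sum>j\<in>{1..n}. z powi (- int j) * B j $$ ik)"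
    "inv_poly pc mc n C z = mat pc mc (\<lambda>ik. \<Sum>j\<in>{1..n}. z powi (- int j) * C j $$ ik)"
    using B C by (blast intro: inv_poly_eq_mat)+
  have ent: "D j $$ (i, k) =
      (if i < pb then if k < mc then 0 else B j $$ (i, k - mc)
       else if k < mc then C j $$ (i - pb, k) else 0)"
    if "j \<in> {1..n}" "i < pb + pc" "k < mb + mc" for j i k
    using that B[OF that(1)] C[OF that(1)] D[OF that(1)] by auto
  show ?thesis
    unfolding eqs by (rule eq_matI) (auto simp: ent)
qed

section \<open>Isometries and co-isometries from blocks\<close>

lemma isometry_block_diag:
  assumes "isometry_on_circle pb mb F" "isometry_on_circle pc mc G"
  shows "isometry_on_circle (pb + pc) (mb + mc)
    (\<lambda>z. four_block_mat (F z) (0\<^sub>m pb mc) (0\<^sub>m pc mb) (G z))"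
  unfolding isometry_on_circle_def
proof (intro conjI allI impI)
  show "mb + mc \<le> pb + pc"
    using assms by (auto simp: isometry_on_circle_def)
next
  fix z :: complex assume "cmod z = 1"
  hence FG: "F z \<in> carrier_mat pb mb" "G z \<in> carrier_mat pc mc"
    and eqs: "mat_adjoint (F z) * F z = 1\<^sub>m mb" "mat_adjoint (G z) * G z = 1\<^sub>m mc"
    using assms by (auto simp: isometry_on_circle_def)
  let ?M = "four_block_mat (F z) (0\<^sub>m pb mc) (0\<^sub>m pc mb) (G z)"
  have ac: "mat_adjoint (F z) \<in> carrier_mat mb pb" "mat_adjoint (G z) \<in> carrier_mat mc pc"
    using FG by simp_all
  have adj: "mat_adjoint ?M =
      four_block_mat (mat_adjoint (F z)) (0\<^sub>m mb pc) (0\<^sub>m mc pb) (mat_adjoint (G z))"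
    by (subst mat_adjoint_four_block_mat[OF FG(1) zero_carrier_mat zero_carrier_mat FG(2)])
      (simp only: mat_adjoint_zero)
  show "?M \<in> carrier_mat (pb + pc) (mb + mc)"
    using FG by simp
  show "mat_adjoint ?M * ?M = 1\<^sub>m (mb + mc)"
    unfolding adj mult_block_diag[OF ac FG] eqs four_block_one_mat ..
qed

lemma isometry_block_antidiag:
  assumes "isometry_on_circle pb mb F" "isometry_on_circle pc mc G"
  shows "isometry_on_circle (pb + pc) (mb + mc)
    (\<lambda>z. four_block_mat (0\<^sub>m pb mc) (F z) (G z) (0\<^sub>m pc mb))"
  unfolding isometry_on_circle_def
proof (intro conjI allI impI)
  show "mb + mc \<le> pb + pc"
    using assms by (auto simp: isometry_on_circle_def)
next
  fix z :: complex assume "cmod z = 1"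
  hence FG: "F z \<in> carrier_mat pb mb" "G z \<in> carrier_mat pc mc"
    and eqs: "mat_adjoint (F z) * F z = 1\<^sub>m mb" "mat_adjoint (G z) * G z = 1\<^sub>m mc"
    using assms by (auto simp: isometry_on_circle_def)
  let ?M = "four_block_mat (0\<^sub>m pb mc) (F z) (G z) (0\<^sub>m pc mb)"
  have ac: "mat_adjoint (F z) \<in> carrier_mat mb pb" "mat_adjoint (G z) \<in> carrier_mat mc pc"
    using FG by simp_all
  have adj: "mat_adjoint ?M =
      four_block_mat (0\<^sub>m mc pb) (mat_adjoint (G z)) (mat_adjoint (F z)) (0\<^sub>m mb pc)"
    by (subst mat_adjoint_four_block_mat[OF zero_carrier_mat FG zero_carrier_mat])
      (simp only: mat_adjoint_zero)
  show "?M \<in> carrier_mat (pb + pc) (mb + mc)"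
    by (rule carrier_matI) simp_all
  \<comment> \<open>the columns of \<open>G z\<close> come first in \<open>?M\<close>, so its \<open>mc\<close> columns index the first block\<close>
  show "mat_adjoint ?M * ?M = 1\<^sub>m (mb + mc)"
    unfolding adj mult_block_antidiag[OF ac(2,1) FG(2,1)] eqs four_block_one_mat
      add.commute[of mb mc] ..
qed

lemma coisometry_block_diag:
  assumes "coisometry_on_circle pb mb F" "coisometry_on_circle pc mc G"
  shows "coisometry_on_circle (pb + pc) (mb + mc)
    (\<lambda>z. four_block_mat (F z) (0\<^sub>m pb mc) (0\<^sub>m pc mb) (G z))"
  unfolding coisometry_on_circle_def
proof (intro conjI allI impI)
  show "pb + pc \<le> mb + mc"
    using assms by (auto simp: coisometry_on_circle_def)
next
  fix z :: complex assume "cmod z = 1"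
  hence FG: "F z \<in> carrier_mat pb mb" "G z \<in> carrier_mat pc mc"
    and eqs: "F z * mat_adjoint (F z) = 1\<^sub>m pb" "G z * mat_adjoint (G z) = 1\<^sub>m pc"
    using assms by (auto simp: coisometry_on_circle_def)
  let ?M = "four_block_mat (F z) (0\<^sub>m pb mc) (0\<^sub>m pc mb) (G z)"
  have ac: "mat_adjoint (F z) \<in> carrier_mat mb pb" "mat_adjoint (G z) \<in> carrier_mat mc pc"
    using FG by simp_all
  have adj: "mat_adjoint ?M =
      four_block_mat (mat_adjoint (F z)) (0\<^sub>m mb pc) (0\<^sub>m mc pb) (mat_adjoint (G z))"
    by (subst mat_adjoint_four_block_mat[OF FG(1) zero_carrier_mat zero_carrier_mat FG(2)])
      (simp only: mat_adjoint_zero)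
  show "?M \<in> carrier_mat (pb + pc) (mb + mc)"
    using FG by simp
  show "?M * mat_adjoint ?M = 1\<^sub>m (pb + pc)"
    unfolding adj mult_block_diag[OF FG ac] eqs four_block_one_mat ..
qed

lemma coisometry_block_antidiag:
  assumes "coisometry_on_circle pb mb F" "coisometry_on_circle pc mc G"
  shows "coisometry_on_circle (pb + pc) (mb + mc)
    (\<lambda>z. four_block_mat (0\<^sub>m pb mc) (F z) (G z) (0\<^sub>m pc mb))"
  unfolding coisometry_on_circle_def
proof (intro conjI allI impI)
  show "pb + pc \<le> mb + mc"
    using assms by (auto simp: coisometry_on_circle_def)
next
  fix z :: complex assume "cmod z = 1"
  hence FG: "F z \<in> carrier_mat pb mb" "G z \<in> carrier_mat pc mc"
    and eqs: "F z * mat_adjoint (F z) = 1\<^sub>m pb" "G z * mat_adjoint (G z) = 1\<^sub>m pc"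
    using assms by (auto simp: coisometry_on_circle_def)
  let ?M = "four_block_mat (0\<^sub>m pb mc) (F z) (G z) (0\<^sub>m pc mb)"
  have ac: "mat_adjoint (F z) \<in> carrier_mat mb pb" "mat_adjoint (G z) \<in> carrier_mat mc pc"
    using FG by simp_all
  have adj: "mat_adjoint ?M =
      four_block_mat (0\<^sub>m mc pb) (mat_adjoint (G z)) (mat_adjoint (F z)) (0\<^sub>m mb pc)"
    by (subst mat_adjoint_four_block_mat[OF zero_carrier_mat FG zero_carrier_mat])
      (simp only: mat_adjoint_zero)
  show "?M \<in> carrier_mat (pb + pc) (mb + mc)"
    by (rule carrier_matI) simp_all
  show "?M * mat_adjoint ?M = 1\<^sub>m (pb + pc)"
    unfolding adj mult_block_antidiag[OF FG ac] eqs four_block_one_mat ..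
qed

theorem mainTheorem9:
  fixes n l pb mb pc mc :: nat
    and B C D :: "nat \<Rightarrow> complex mat"
  assumes nl: "n \<ge> l"
    and B: "\<And>j. 1 \<le> j \<Longrightarrow> j \<le> n \<Longrightarrow> B j \<in> carrier_mat pb mb"
    and C: "\<And>j. 1 \<le> j \<Longrightarrow> j \<le> l \<Longrightarrow> C j \<in> carrier_mat pc mc"
    and C0: "\<And>j. l < j \<Longrightarrow> j \<le> n \<Longrightarrow> C j = 0\<^sub>m pc mc"
    and D: "(\<forall>j\<in>{1..n}. D j = four_block_mat (B j) (0\<^sub>m pb mc) (0\<^sub>m pc mb) (C j)) \<or>
            (\<forall>j\<in>{1..n}. D j = four_block_mat (0\<^sub>m pb mc) (B j) (C j) (0\<^sub>m pc mb))"
  shows "(isometry_on_circle pb mb (inv_poly pb mb n B) \<and>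
            isometry_on_circle pc mc (inv_poly pc mc l C) \<longrightarrow>
          isometry_on_circle (pb + pc) (mb + mc) (inv_poly (pb + pc) (mb + mc) n D)) \<and>
         (coisometry_on_circle pb mb (inv_poly pb mb n B) \<and>
            coisometry_on_circle pc mc (inv_poly pc mc l C) \<longrightarrow>
          coisometry_on_circle (pb + pc) (mb + mc) (inv_poly (pb + pc) (mb + mc) n D))"
proof -
  have Bn: "B j \<in> carrier_mat pb mb" if "j \<in> {1..n}" for j
    using that B by simp
  have Cn: "C j \<in> carrier_mat pc mc" if "j \<in> {1..n}" for j
    using that C[of j] C0[of j] by (cases "j \<le> l") auto
  have Cl: "inv_poly pc mc l C = inv_poly pc mc n C"
    by (rule ext, rule inv_poly_extend_zero[symmetric]) (use nl C C0 in auto)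
  from D show ?thesis
  proof
    assume "\<forall>j\<in>{1..n}. D j = four_block_mat (B j) (0\<^sub>m pb mc) (0\<^sub>m pc mb) (C j)"
    hence "inv_poly (pb + pc) (mb + mc) n D =
        (\<lambda>z. four_block_mat (inv_poly pb mb n B z) (0\<^sub>m pb mc) (0\<^sub>m pc mb)
          (inv_poly pc mc n C z))"
      by (intro ext inv_poly_block_diag[OF Bn Cn]) auto
    thus ?thesis
      unfolding Cl by (simp add: isometry_block_diag coisometry_block_diag)
  next
    assume "\<forall>j\<in>{1..n}. D j = four_block_mat (0\<^sub>m pb mc) (B j) (C j) (0\<^sub>m pc mb)"
    hence "inv_poly (pb + pc) (mb + mc) n D =
        (\<lambda>z. four_block_mat (0\<^sub>m pb mc) (inv_poly pb mb n B z) (inv_poly pc mc n C z)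
          (0\<^sub>m pc mb))"
      by (intro ext inv_poly_block_antidiag[OF Bn Cn]) auto
    thus ?thesis
      unfolding Cl by (simp add: isometry_block_antidiag coisometry_block_antidiag)
  qed
qed

end
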